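(* Let $b$ be a connected, locally finite and weakly spherically symmetric weighted graph over $(X,m)$ with root $o\in X$. Consider the following assertions. (i) The graph is $\chi$-complete and there exists a sequence of cut-off functions which are radially symmetric (with respect to $o$). (ii) There exists an intrinsic pseudo metric $\sigma$ with finite balls such that the function $\sigma(o,\cdot)$ is radially symmetric (with respect to $o$). (iii) $$\sum_{r=1}^\infty\frac{\sqrt{m(S_r)\wedge m(S_{r+1})}}{\sqrt{|\partial B_r|}}=\infty.$$ (iv) There exists an intrinsic metric with finite balls. (v) $$\sum_{r=1}^\infty\frac{\sqrt{m(S_r)}}{\sqrt{|\partial B_r|}}=\sum_{r=1}^\infty\frac1{\sqrt{\kappa_+(r)}}=\infty.$$ Then (i), (ii) and (iii) are equivalent, each of them implies (iv), and (iv) implies (v). If, moreover, there exists $K>0$ such that $m(S_r)\le K\,m(S_{r+1})$ for all $r\ge1$, then all assertions (i)–(v) are equivalent.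
   Context: $X$ is a nonempty countable set and $m\colon X\to(0,\infty)$; write $m(A)=\sum_{x\in A}m(x)$ for $A\subseteq X$. A weighted graph over $(X,m)$ is a symmetric function $b\colon X\times X\to[0,\infty)$ with $b(x,x)=0$ and $\sum_{y\in X}b(x,y)<\infty$ for all $x\in X$. Write $x\sim y$ if $b(x,y)>0$. The graph is locally finite if $\{y\in X\mid y\sim x\}$ is finite for every $x$; it is connected if for all $x,y\in X$ there is a finite sequence $x=x_0\sim x_1\sim\dots\sim x_n=y$ ($n\ge0$). The combinatorial distance $d(x,y)$ is the least such $n$. A pseudo metric on $X$ is a symmetric function $\sigma\colon X\times X\to[0,\infty)$ with $\sigma(x,x)=0$ satisfying the triangle inequality; it is a metric if moreover $\sigma(x,y)=0$ only for $x=y$. It is intrinsic (with respect to $b$ and $m$) if $\frac1{m(x)}\sum_{y\in X}b(x,y)\sigma(x,y)^2\le1$ for every $x\in X$. It has finite balls if $\{y\in X\mid\sigma(x,y)\le R\}$ is finite for all $x\in X$ and $R\ge 0$. For $f\colon X\to\mathbb R$ let $|\nabla f|(x)=\left(\frac1{m(x)}\sum_{y\in X}b(x,y)(f(x)-f(y))^2\right)^{1/2}$. The graph $b$ over $(X,m)$ is $\chi$-complete if there exist a sequence $(\chi_n)$ of finitely supported functions $\chi_n\colon X\to\mathbb R$ with $\chi_n\to1$ pointwise and a constant $C>0$ with $|\nabla\chi_n|\le C$ on $X$ for all $n\in\mathbb N$; such a sequence is called a sequence of cut-off functions. Fix $o\in X$. A function $f\colon X\to\mathbb R$ is radially symmetric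 (with respect to $o$) if $f(x)$ depends only on $d(x,o)$; in that case $f(r)$ denotes the value $f(x)$ for $d(x,o)=r$. For $r\in\mathbb N_0$ let $S_r=\{x\in X\mid d(x,o)=r\}$, $S_{-1}=\emptyset$, and $B_r=\{x\in X\mid d(x,o)\le r\}$. Define $$\kappa_\pm(x)=\frac1{m(x)}\sum_{y\in S_{r\pm1}}b(x,y)\quad\text{if }x\in S_r.$$ The graph is weakly spherically symmetric with root $o$ if $\kappa_+$ and $\kappa_-$ are both radially symmetric with respect to $o$. In this case $|\partial B_r|:=\kappa_+(r)\,m(S_r)=\sum_{x\in S_r,\,y\in S_{r+1}}b(x,y)$. The symbol $\wedge$ denotes the minimum. *)

theory Defs
  imports "HOL-Analysis.Analysis"
begin

text \<open>
  The vertex set \<open>X\<close> is the universe of a type \<open>'a\<close> of class \<open>countable\<close>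
  (finite or countably infinite, and nonempty as every type is).
\<close>

subsection \<open>Weighted graphs\<close>

definition weighted_graph :: "('a::countable \<Rightarrow> 'a \<Rightarrow> real) \<Rightarrow> ('a \<Rightarrow> real) \<Rightarrow> bool" where
  "weighted_graph b m \<longleftrightarrow>
     (\<forall>x. m x > 0) \<and>
     (\<forall>x y. b x y \<ge> 0) \<and>
     (\<forall>x y. b x y = b y x) \<and>
     (\<forall>x. b x x = 0) \<and>
     (\<forall>x. b x summable_on UNIV)"

text \<open>As a real infinite sum, \<open>vol m A\<close> is \<open>0\<close> where \<open>m(A) = \<infinity>\<close>. It is only used for
  spheres, which are finite in connected locally finite graphs.\<close>

definition vol :: "('a::countable \<Rightarrow> real) \<Rightarrow> 'a set \<Rightarrow> real" where
  "vol m A = (\<Sum>\<^sub>\<infinity>x\<in>A. m x)"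

definition adjacent :: "('a::countable \<Rightarrow> 'a \<Rightarrow> real) \<Rightarrow> 'a \<Rightarrow> 'a \<Rightarrow> bool" where
  "adjacent b x y \<longleftrightarrow> b x y > 0"

definition locally_finite_graph :: "('a::countable \<Rightarrow> 'a \<Rightarrow> real) \<Rightarrow> bool" where
  "locally_finite_graph b \<longleftrightarrow> (\<forall>x. finite {y. adjacent b y x})"

text \<open>The relational power \<open>(adjacent b ^^ n) x y\<close> says that there is a sequence
  \<open>x = x\<^sub>0 \<sim> x\<^sub>1 \<sim> \<dots> \<sim> x\<^sub>n = y\<close>.\<close>

definition connected_graph :: "('a::countable \<Rightarrow> 'a \<Rightarrow> real) \<Rightarrow> bool" where
  "connected_graph b \<longleftrightarrow> (\<forall>x y. \<exists>n. (adjacent b ^^ n) x y)"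

definition comb_dist :: "('a::countable \<Rightarrow> 'a \<Rightarrow> real) \<Rightarrow> 'a \<Rightarrow> 'a \<Rightarrow> nat" where
  "comb_dist b x y = (LEAST n. (adjacent b ^^ n) x y)"

subsection \<open>Intrinsic metrics\<close>

definition pseudo_metric :: "('a::countable \<Rightarrow> 'a \<Rightarrow> real) \<Rightarrow> bool" where
  "pseudo_metric \<sigma> \<longleftrightarrow>
     (\<forall>x y. \<sigma> x y \<ge> 0) \<and>
     (\<forall>x y. \<sigma> x y = \<sigma> y x) \<and>
     (\<forall>x. \<sigma> x x = 0) \<and>
     (\<forall>x y z. \<sigma> x z \<le> \<sigma> x y + \<sigma> y z)"

definition is_metric :: "('a::countable \<Rightarrow> 'a \<Rightarrow> real) \<Rightarrow> bool" where
  "is_metric \<sigma> \<longleftrightarrow> pseudo_metric \<sigma> \<and> (\<forall>x y. \<sigma> x y = 0 \<longrightarrow> x = y)"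

definition intrinsic ::
  "('a::countable \<Rightarrow> 'a \<Rightarrow> real) \<Rightarrow> ('a \<Rightarrow> real) \<Rightarrow> ('a \<Rightarrow> 'a \<Rightarrow> real) \<Rightarrow> bool" where
  "intrinsic b m \<sigma> \<longleftrightarrow>
     (\<forall>x. (\<lambda>y. b x y * (\<sigma> x y)\<^sup>2) summable_on UNIV \<and>
          1 / m x * (\<Sum>\<^sub>\<infinity>y. b x y * (\<sigma> x y)\<^sup>2) \<le> 1)"

definition finite_balls :: "('a::countable \<Rightarrow> 'a \<Rightarrow> real) \<Rightarrow> bool" where
  "finite_balls \<sigma> \<longleftrightarrow> (\<forall>x. \<forall>R\<ge>0. finite {y. \<sigma> x y \<le> R})"

subsection \<open>Cut-off functions\<close>

text \<open>The real infinite sum in \<open>grad_norm\<close> is meaningful where it converges. It converges for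
  every bounded \<open>f\<close>, hence for every finitely supported one, since \<open>b x\<close> is summable.\<close>

definition grad_norm ::
  "('a::countable \<Rightarrow> 'a \<Rightarrow> real) \<Rightarrow> ('a \<Rightarrow> real) \<Rightarrow> ('a \<Rightarrow> real) \<Rightarrow> 'a \<Rightarrow> real" where
  "grad_norm b m f x = sqrt (1 / m x * (\<Sum>\<^sub>\<infinity>y. b x y * (f x - f y)\<^sup>2))"

definition cutoff_sequence ::
  "('a::countable \<Rightarrow> 'a \<Rightarrow> real) \<Rightarrow> ('a \<Rightarrow> real) \<Rightarrow> (nat \<Rightarrow> 'a \<Rightarrow> real) \<Rightarrow> bool" where
  "cutoff_sequence b m \<phi> \<longleftrightarrow>
     (\<forall>n. finite {x. \<phi> n x \<noteq> 0}) \<and>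
     (\<forall>x. (\<lambda>n. \<phi> n x) \<longlonglongrightarrow> 1) \<and>
     (\<exists>C>0. \<forall>n x. grad_norm b m (\<phi> n) x \<le> C)"

definition chi_complete :: "('a::countable \<Rightarrow> 'a \<Rightarrow> real) \<Rightarrow> ('a \<Rightarrow> real) \<Rightarrow> bool" where
  "chi_complete b m \<longleftrightarrow> (\<exists>\<phi>. cutoff_sequence b m \<phi>)"

subsection \<open>Weak spherical symmetry\<close>

definition radially_symmetric ::
  "('a::countable \<Rightarrow> 'a \<Rightarrow> real) \<Rightarrow> 'a \<Rightarrow> ('a \<Rightarrow> real) \<Rightarrow> bool" where
  "radially_symmetric b x\<^sub>0 f \<longleftrightarrow>
     (\<forall>x y. comb_dist b x x\<^sub>0 = comb_dist b y x\<^sub>0 \<longrightarrow> f x = f y)"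

definition dsphere :: "('a::countable \<Rightarrow> 'a \<Rightarrow> real) \<Rightarrow> 'a \<Rightarrow> nat \<Rightarrow> 'a set" where
  "dsphere b x\<^sub>0 r = {x. comb_dist b x x\<^sub>0 = r}"

text \<open>\<open>f(r)\<close> for radially symmetric \<open>f\<close>; it is set to \<open>0\<close> if the sphere \<open>S\<^sub>r\<close> is empty,
  which can happen only for \<open>r \<ge> 1\<close> and finite \<open>X\<close> if the graph is connected and
  locally finite.\<close>

definition radial_value ::
  "('a::countable \<Rightarrow> 'a \<Rightarrow> real) \<Rightarrow> 'a \<Rightarrow> ('a \<Rightarrow> real) \<Rightarrow> nat \<Rightarrow> real" where
  "radial_value b x\<^sub>0 f r =
     (if dsphere b x\<^sub>0 r = {} then 0 else f (SOME x. x \<in> dsphere b x\<^sub>0 r))"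

definition kappa_plus ::
  "('a::countable \<Rightarrow> 'a \<Rightarrow> real) \<Rightarrow> ('a \<Rightarrow> real) \<Rightarrow> 'a \<Rightarrow> 'a \<Rightarrow> real" where
  "kappa_plus b m x\<^sub>0 x =
     1 / m x * (\<Sum>\<^sub>\<infinity>y\<in>dsphere b x\<^sub>0 (comb_dist b x x\<^sub>0 + 1). b x y)"

text \<open>The first case is the convention \<open>S\<^sub>-\<^sub>1 = \<emptyset>\<close>.\<close>

definition kappa_minus ::
  "('a::countable \<Rightarrow> 'a \<Rightarrow> real) \<Rightarrow> ('a \<Rightarrow> real) \<Rightarrow> 'a \<Rightarrow> 'a \<Rightarrow> real" where
  "kappa_minus b m x\<^sub>0 x =
     (if comb_dist b x x\<^sub>0 = 0 then 0
      else 1 / m x * (\<Sum>\<^sub>\<infinity>y\<in>dsphere b x\<^sub>0 (comb_dist b x x\<^sub>0 - 1). b x y))"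

definition weakly_spherically_symmetric ::
  "('a::countable \<Rightarrow> 'a \<Rightarrow> real) \<Rightarrow> ('a \<Rightarrow> real) \<Rightarrow> 'a \<Rightarrow> bool" where
  "weakly_spherically_symmetric b m x\<^sub>0 \<longleftrightarrow>
     radially_symmetric b x\<^sub>0 (kappa_plus b m x\<^sub>0) \<and>
     radially_symmetric b x\<^sub>0 (kappa_minus b m x\<^sub>0)"

definition boundary_measure ::
  "('a::countable \<Rightarrow> 'a \<Rightarrow> real) \<Rightarrow> ('a \<Rightarrow> real) \<Rightarrow> 'a \<Rightarrow> nat \<Rightarrow> real" where
  "boundary_measure b m x\<^sub>0 r =
     radial_value b x\<^sub>0 (kappa_plus b m x\<^sub>0) r * vol m (dsphere b x\<^sub>0 r)"

text \<open>
  Quotient with values in \<open>[0,\<infinity>]\<close>, where \<open>a / 0 = \<infinity>\<close>, also for \<open>a = 0\<close>. For infinite \<open>X\<close>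
  the denominators \<open>|\<partial>B\<^sub>r|\<close> and \<open>\<kappa>\<^sub>+(r)\<close> are positive and the convention plays no role. For
  finite \<open>X\<close> they vanish for large \<open>r\<close>; the convention then makes the series infinite, in
  accordance with the fact that finite graphs are complete in every sense.
\<close>

definition ext_quotient :: "real \<Rightarrow> real \<Rightarrow> ennreal" where
  "ext_quotient a c = (if c = 0 then \<infinity> else ennreal (a / c))"

end

theory Submission
  imports Defs
begin

text \<open>
  Weak spherical symmetry gives \<open>|\<partial>B\<^sub>r| = \<kappa>\<^sub>+(r) m(S\<^sub>r) = \<kappa>\<^sub>-(r+1) m(S\<^sub>r\<^sub>+\<^sub>1)\<close>, the total weight of
  the edges between two consecutive spheres, counted from either side. Therefore the terms
  \<open>w(r) = sqrt (min (m(S\<^sub>r)) (m(S\<^sub>r\<^sub>+\<^sub>1)) / |\<partial>B\<^sub>r|)\<close> of the series (iii) are the minima of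
  \<open>1 / sqrt (\<kappa>\<^sub>+(r))\<close> and \<open>1 / sqrt (\<kappa>\<^sub>-(r+1))\<close>. The energy of a radial function at \<open>x \<in> S\<^sub>r\<close>
  only involves \<open>\<kappa>\<^sub>\<plusminus>(r)\<close> and its increments to the two adjacent spheres
  (\<open>radial_energy\<close>), so up to constants \<open>w(r)\<close> is the largest increment between \<open>S\<^sub>r\<close> and
  \<open>S\<^sub>r\<^sub>+\<^sub>1\<close> that a radial function with bounded gradient can have
  (\<open>kappa_width\<close> and \<open>width_maximal\<close>).

  If (iii) holds, the differences of the partial sums of \<open>w / sqrt 2\<close> form a pseudo metric as
  in (ii): it is intrinsic since the edges outwards and inwards each contribute at most one half,
  and its balls are finite since the partial sums are unbounded and spheres are finite.
  Given (ii), truncating \<open>1 - \<sigma>(x\<^sub>0, \<cdot>) / n\<close> at \<open>0\<close> gives the cut-off functions of (i). Given (i),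
  a radial cut-off function with gradient bounded by \<open>C\<close> decreases from nearly \<open>1\<close> at a fixed
  sphere to \<open>0\<close> in steps of size at most \<open>C w(r)\<close>, so the tails of the series cannot be small.

  Every locally finite graph carries some intrinsic metric (\<open>exists_intrinsic_metric\<close>), and its
  average with a pseudo metric as in (ii) is a metric as in (iv). For an intrinsic metric with
  finite balls, each \<open>x \<in> S\<^sub>r\<close> has a point of \<open>S\<^sub>r\<^sub>+\<^sub>1\<close> within distance \<open>1 / sqrt (\<kappa>\<^sub>+(r))\<close>, since
  the weighted mean of the squared distances to \<open>S\<^sub>r\<^sub>+\<^sub>1\<close> is at most \<open>1 / \<kappa>\<^sub>+(r)\<close>
  (\<open>short_outward_step\<close>). If the series (v) converged, such steps would form an infinite path
  inside a ball. Finally, \<open>m(S\<^sub>r) \<le> K m(S\<^sub>r\<^sub>+\<^sub>1)\<close> makes the terms of (iii) and (v) comparable.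

  Finite graphs need little extra care: in both series some denominator vanishes, so the
  assumption that a series is finite already forces all spheres to be nonempty.
\<close>

section \<open>Series of extended quotients\<close>

text \<open>This turns the extended series into real ones: a single vanishing denominator
  already makes the series infinite.\<close>

lemma suminf_ext_quotient_finite_iff:
  assumes "\<And>r. a r \<ge> 0" "\<And>r. c r \<ge> 0"
  shows "(\<Sum>r. ext_quotient (a r) (c r)) \<noteq> \<infinity> \<longleftrightarrow> (\<forall>r. c r \<noteq> 0) \<and> summable (\<lambda>r. a r / c r)"
proof (cases "\<forall>r. c r \<noteq> 0")
  case True
  then have eq: "(\<lambda>r. ext_quotient (a r) (c r)) = (\<lambda>r. ennreal (a r / c r))"
    by (auto simp: ext_quotient_def)
  have nonneg: "a r / c r \<ge> 0" for r
    using assms by simp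
  show ?thesis
  proof
    assume "(\<Sum>r. ext_quotient (a r) (c r)) \<noteq> \<infinity>"
    then have "summable (\<lambda>r. a r / c r)"
      by (intro summable_suminf_not_top nonneg) (simp add: eq)
    with True show "(\<forall>r. c r \<noteq> 0) \<and> summable (\<lambda>r. a r / c r)" by simp
  next
    assume "(\<forall>r. c r \<noteq> 0) \<and> summable (\<lambda>r. a r / c r)"
    then show "(\<Sum>r. ext_quotient (a r) (c r)) \<noteq> \<infinity>"
      by (simp only: eq suminf_ennreal2[OF nonneg]) simp
  qed
next
  case False
  then obtain r where "c r = 0" by blast
  then have "\<infinity> \<le> ext_quotient (a r) (c r)"
    by (simp add: ext_quotient_def)
  also have "\<dots> = (\<Sum>k\<in>{r}. ext_quotient (a k) (c k))" by simp
  also have "\<dots> \<le> (\<Sum>r. ext_quotient (a r) (c r))"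
    by (intro sum_le_suminf) auto
  finally show ?thesis using False by (simp add: top_unique)
qed

section \<open>Spheres and sums over neighbours\<close>

locale rooted_graph =
  fixes b :: "'a::countable \<Rightarrow> 'a \<Rightarrow> real" and m :: "'a \<Rightarrow> real" and x\<^sub>0 :: 'a
  assumes weighted: "weighted_graph b m"
    and connected: "connected_graph b"
    and locally_finite: "locally_finite_graph b"
begin

abbreviation depth :: "'a \<Rightarrow> nat" where "depth x \<equiv> comb_dist b x x\<^sub>0"
abbreviation S :: "nat \<Rightarrow> 'a set" where "S \<equiv> dsphere b x\<^sub>0"

lemma m_pos: "m x > 0"
  and b_nonneg: "b x y \<ge> 0"
  and b_sym: "b x y = b y x"
  using weighted unfolding weighted_graph_def by blast+

lemma adjacent_sym: "adjacent b x y \<longleftrightarrow> adjacent b y x"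
  by (simp add: adjacent_def b_sym)

lemma b_eq_0: "\<not> adjacent b x y \<Longrightarrow> b x y = 0"
  using b_nonneg[of x y] by (simp add: adjacent_def)

lemma finite_neighbours: "finite {y. adjacent b y x}"
  using locally_finite by (simp add: locally_finite_graph_def)

lemma in_S_iff: "x \<in> S r \<longleftrightarrow> depth x = r"
  by (simp add: dsphere_def)

lemma walk_depth: "(adjacent b ^^ depth x) x x\<^sub>0"
proof -
  obtain n where "(adjacent b ^^ n) x x\<^sub>0"
    using connected unfolding connected_graph_def by blast
  then show ?thesis unfolding comb_dist_def by (rule LeastI)
qed

lemma depth_le_walk: "(adjacent b ^^ n) x x\<^sub>0 \<Longrightarrow> depth x \<le> n"
  unfolding comb_dist_def by (rule Least_le)

lemma depth_adjacent: "adjacent b x y \<Longrightarrow> depth x \<le> Suc (depth y)"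
  by (rule depth_le_walk) (rule relpowp_Suc_I2[OF _ walk_depth])

text \<open>The first step of a shortest path to the root.\<close>

lemma predecessor:
  assumes "depth x = Suc r"
  obtains y where "adjacent b x y" "depth y = r"
proof -
  obtain y where y: "adjacent b x y" "(adjacent b ^^ r) y x\<^sub>0"
    using walk_depth[of x] assms by (metis relpowp_Suc_D2)
  have "depth y = r"
    using depth_le_walk[OF y(2)] depth_adjacent[OF y(1)] assms by simp
  with y(1) show thesis by (rule that)
qed

lemma finite_S: "finite (S r)"
proof (induction r)
  case 0
  have "x = x\<^sub>0" if "x \<in> S 0" for x
    using walk_depth[of x] that by (simp add: in_S_iff)
  then have "S 0 \<subseteq> {x\<^sub>0}" by blast
  then show ?case by (rule finite_subset) simp
next
  case (Suc r)
  have "S (Suc r) \<subseteq> (\<Union>y\<in>S r. {x. adjacent b x y})"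
    by (metis (mono_tags, lifting) UN_iff in_S_iff mem_Collect_eq predecessor subsetI)
  then show ?case
    by (rule finite_subset) (simp add: Suc finite_neighbours)
qed

lemma S_nonempty_antimono:
  assumes "S (Suc r) \<noteq> {}" shows "S r \<noteq> {}"
  using assms by (auto simp: in_S_iff set_eq_iff elim: predecessor)

lemma S_nonempty:
  assumes "infinite (UNIV :: 'a set)" shows "S r \<noteq> {}"
proof
  assume empty: "S r = {}"
  have "S (r + k) = {}" for k
    by (induction k) (use empty S_nonempty_antimono in auto)
  then have "depth x < r" for x
    by (metis empty_iff in_S_iff le_add_diff_inverse not_less)
  then have "UNIV \<subseteq> (\<Union>k<r. S k)"
    by (auto simp: in_S_iff)
  then show False
    using assms finite_S by (metis finite_UN finite_lessThan finite_subset)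
qed

lemma vol_S: "vol m (S r) = (\<Sum>x\<in>S r. m x)"
  by (simp add: vol_def finite_S)

lemma vol_S_pos_iff: "vol m (S r) > 0 \<longleftrightarrow> S r \<noteq> {}"
  by (auto simp: vol_S intro!: sum_pos finite_S m_pos)

lemma vol_S_nonneg: "vol m (S r) \<ge> 0"
  by (simp add: vol_S sum_nonneg m_pos less_imp_le)

lemma summable_neighbours: "(\<lambda>y. b x y * f y) summable_on UNIV"
proof -
  have "(\<lambda>y. b x y * f y) summable_on {y. adjacent b y x}"
    by (simp add: finite_neighbours)
  then show ?thesis
    by (rule summable_on_cong_neutral[THEN iffD1, rotated -1])
       (auto simp: b_eq_0 adjacent_sym)
qed

lemma infsum_b_mono:
  assumes "\<And>y. adjacent b x y \<Longrightarrow> f y \<le> g y"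
  shows "(\<Sum>\<^sub>\<infinity>y. b x y * f y) \<le> (\<Sum>\<^sub>\<infinity>y. b x y * g y)"
  by (rule infsum_mono[OF summable_neighbours summable_neighbours])
     (metis assms b_eq_0 b_nonneg mult_left_mono mult_zero_left order_refl)

lemma kappa_plus_sum: "m x * kappa_plus b m x\<^sub>0 x = (\<Sum>y\<in>S (Suc (depth x)). b x y)"
  using m_pos[of x] by (simp add: kappa_plus_def finite_S)

lemma kappa_minus_sum:
  "depth x = Suc r \<Longrightarrow> m x * kappa_minus b m x\<^sub>0 x = (\<Sum>y\<in>S r. b x y)"
  using m_pos[of x] by (simp add: kappa_minus_def finite_S)

lemma kappa_plus_nonneg: "kappa_plus b m x\<^sub>0 x \<ge> 0"
  unfolding kappa_plus_def using m_pos[of x] b_nonneg by (simp add: infsum_nonneg)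

lemma kappa_minus_nonneg: "kappa_minus b m x\<^sub>0 x \<ge> 0"
  unfolding kappa_minus_def using m_pos[of x] b_nonneg by (simp add: infsum_nonneg)

text \<open>Neighbours lie on the same sphere or on an adjacent one. Those on the same sphere contribute
  nothing. At the root, \<open>depth x - 1\<close> is again \<open>0\<close> and \<open>kappa_minus\<close> vanishes.\<close>

lemma radial_energy:
  fixes g :: "nat \<Rightarrow> real"
  shows "(\<Sum>\<^sub>\<infinity>y. b x y * (g (depth x) - g (depth y))\<^sup>2) =
    m x * (kappa_plus b m x\<^sub>0 x * (g (depth x) - g (Suc (depth x)))\<^sup>2 +
           kappa_minus b m x\<^sub>0 x * (g (depth x) - g (depth x - 1))\<^sup>2)"
proof -
  let ?e = "\<lambda>y. b x y * (g (depth x) - g (depth y))\<^sup>2"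
  let ?up = "S (Suc (depth x))" and ?down = "{y. Suc (depth y) = depth x}"
  have fin: "finite ?down"
    by (rule finite_subset[OF _ finite_S[of "depth x - 1"]]) (auto simp: in_S_iff)
  have "(\<Sum>\<^sub>\<infinity>y. ?e y) = (\<Sum>\<^sub>\<infinity>y\<in>?up \<union> ?down. ?e y)"
  proof (rule infsum_cong_neutral)
    fix y assume y: "y \<in> UNIV - (?up \<union> ?down)"
    show "?e y = 0"
    proof (cases "adjacent b x y")
      case True
      with depth_adjacent[of x y] depth_adjacent[of y x] y
      have "depth x = depth y" by (auto simp: in_S_iff adjacent_sym)
      then show ?thesis by simp
    qed (simp add: b_eq_0)
  qed auto
  also have "\<dots> = (\<Sum>y\<in>?up. ?e y) + (\<Sum>y\<in>?down. ?e y)"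
    using fin finite_S by (simp, intro sum.union_disjoint) (auto simp: in_S_iff)
  also have "(\<Sum>y\<in>?up. ?e y) = (\<Sum>y\<in>?up. b x y) * (g (depth x) - g (Suc (depth x)))\<^sup>2"
    unfolding sum_distrib_right by (rule sum.cong) (auto simp: in_S_iff)
  also have "(\<Sum>y\<in>?down. ?e y) =
      m x * kappa_minus b m x\<^sub>0 x * (g (depth x) - g (depth x - 1))\<^sup>2"
  proof (cases "depth x")
    case 0
    then show ?thesis by (simp add: kappa_minus_def)
  next
    case (Suc r)
    then have "?down = S r" by (auto simp: in_S_iff)
    then have "(\<Sum>y\<in>?down. ?e y) = (\<Sum>y\<in>S r. b x y * (g (depth x) - g r)\<^sup>2)"
      by (auto simp: in_S_iff intro!: sum.cong)
    also have "\<dots> = (\<Sum>y\<in>S r. b x y) * (g (depth x) - g r)\<^sup>2"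
      by (simp add: sum_distrib_right)
    finally show ?thesis
      using Suc by (simp add: kappa_minus_sum[OF Suc])
  qed
  finally show ?thesis
    by (simp add: kappa_plus_sum[symmetric] algebra_simps)
qed

lemma radial_value_eq:
  assumes "radially_symmetric b x\<^sub>0 f"
  shows "radial_value b x\<^sub>0 f (depth x) = f x"
proof -
  have "x \<in> S (depth x)" by (simp add: in_S_iff)
  then have "(SOME y. y \<in> S (depth x)) \<in> S (depth x)" by (rule someI)
  then have "f (SOME y. y \<in> S (depth x)) = f x"
    using assms unfolding radially_symmetric_def in_S_iff by blast
  then show ?thesis
    using \<open>x \<in> S (depth x)\<close> by (auto simp: radial_value_def)
qed

section \<open>Intrinsic metrics\<close>

lemma intrinsic_iff:
  "intrinsic b m \<sigma> \<longleftrightarrow> (\<forall>x. (\<Sum>\<^sub>\<infinity>y. b x y * (\<sigma> x y)\<^sup>2) \<le> m x)"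
  using m_pos by (simp add: intrinsic_def summable_neighbours pos_divide_le_eq)

text \<open>A function \<open>h > 0\<close> induces the ultrametric \<open>max (h x) (h y)\<close>. It is intrinsic as soon as
  this maximum is at most \<open>sqrt (m x / (1 + deg x))\<close> for all neighbours \<open>y\<close> of \<open>x\<close>. Taking for \<open>h\<close>
  the minimum of these bounds over a vertex and its neighbours achieves that, and local finiteness
  keeps \<open>h\<close> positive.\<close>

lemma exists_intrinsic_metric: "\<exists>\<tau>. is_metric \<tau> \<and> intrinsic b m \<tau>"
proof -
  define deg where "deg x = (\<Sum>\<^sub>\<infinity>y. b x y)" for x
  \<comment> \<open>The summand 1 covers the graph with a single vertex, whose degree is zero.\<close>
  define c where "c x = sqrt (m x / (1 + deg x))" for x
  define h where "h x = Min (c ` insert x {y. adjacent b y x})" for x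
  define \<tau> where "\<tau> x y = (if x = y then 0 else max (h x) (h y))" for x y
  have deg_nonneg: "deg x \<ge> 0" for x
    unfolding deg_def by (rule infsum_nonneg) (rule b_nonneg)
  have c_pos: "c x > 0" for x
    using deg_nonneg[of x] m_pos[of x] by (simp add: c_def)
  have fin: "finite (c ` insert x {y. adjacent b y x})" for x
    by (simp add: finite_neighbours)
  have h_pos: "h x > 0" for x
    unfolding h_def using fin c_pos by (subst Min_gr_iff) auto
  have h_le: "h y \<le> c x" if "y = x \<or> adjacent b x y" for x y
    unfolding h_def using fin that by (intro Min_le) auto
  have "is_metric \<tau>"
    unfolding is_metric_def pseudo_metric_def \<tau>_def using h_pos by (smt (verit))
  moreover have "intrinsic b m \<tau>"
    unfolding intrinsic_iff
  proof
    fix x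
    have "(\<Sum>\<^sub>\<infinity>y. b x y * (\<tau> x y)\<^sup>2) \<le> (\<Sum>\<^sub>\<infinity>y. b x y * (c x)\<^sup>2)"
    proof (rule infsum_b_mono)
      fix y assume "adjacent b x y"
      then have "\<tau> x y \<le> c x" "\<tau> x y \<ge> 0"
        using h_le h_pos c_pos by (auto simp: \<tau>_def less_imp_le le_max_iff_disj)
      then show "(\<tau> x y)\<^sup>2 \<le> (c x)\<^sup>2" by (rule power_mono)
    qed
    also have "\<dots> = deg x * (c x)\<^sup>2"
      unfolding deg_def by (rule infsum_cmult_left')
    also have "\<dots> = deg x * (m x / (1 + deg x))"
      using deg_nonneg[of x] m_pos[of x] by (simp add: c_def)
    also have "\<dots> \<le> m x"
      using deg_nonneg[of x] m_pos[of x] by (simp add: field_simps)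
    finally show "(\<Sum>\<^sub>\<infinity>y. b x y * (\<tau> x y)\<^sup>2) \<le> m x" .
  qed
  ultimately show ?thesis by blast
qed

text \<open>The average with any intrinsic metric separates points, stays intrinsic because the square
  is convex, and has finite balls because it dominates \<open>\<sigma> / 2\<close>.\<close>

lemma intrinsic_metric_of_pseudo_metric:
  assumes "pseudo_metric \<sigma>" "intrinsic b m \<sigma>" "finite_balls \<sigma>"
  shows "\<exists>\<sigma>'. is_metric \<sigma>' \<and> intrinsic b m \<sigma>' \<and> finite_balls \<sigma>'"
proof -
  obtain \<tau> where \<tau>: "is_metric \<tau>" "intrinsic b m \<tau>"
    using exists_intrinsic_metric by blast
  define \<sigma>' where "\<sigma>' x y = (\<sigma> x y + \<tau> x y) / 2" for x y
  have nonneg: "\<sigma> x y \<ge> 0" "\<tau> x y \<ge> 0" for x y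
    using assms(1) \<tau>(1) by (auto simp: is_metric_def pseudo_metric_def)
  have "pseudo_metric \<sigma>'"
    unfolding pseudo_metric_def
  proof (intro conjI allI)
    fix x y z
    have "\<sigma> x z \<le> \<sigma> x y + \<sigma> y z" "\<tau> x z \<le> \<tau> x y + \<tau> y z"
      using assms(1) \<tau>(1) by (auto simp: is_metric_def pseudo_metric_def)
    then show "\<sigma>' x z \<le> \<sigma>' x y + \<sigma>' y z"
      by (simp add: \<sigma>'_def field_simps)
  qed (use assms(1) \<tau>(1) in \<open>auto simp: is_metric_def pseudo_metric_def \<sigma>'_def\<close>)
  moreover have "\<forall>x y. \<sigma>' x y = 0 \<longrightarrow> x = y"
  proof (intro allI impI)
    fix x y assume "\<sigma>' x y = 0"
    then have "\<tau> x y = 0" using nonneg[of x y] by (simp add: \<sigma>'_def)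
    then show "x = y" using \<tau>(1) by (simp add: is_metric_def)
  qed
  moreover have "intrinsic b m \<sigma>'"
    unfolding intrinsic_iff
  proof
    fix x
    have "(\<Sum>\<^sub>\<infinity>y. b x y * (\<sigma>' x y)\<^sup>2) \<le>
        (\<Sum>\<^sub>\<infinity>y. b x y * ((1/2) * (\<sigma> x y)\<^sup>2 + (1/2) * (\<tau> x y)\<^sup>2))"
    proof (rule infsum_b_mono)
      fix y
      have "0 \<le> (\<sigma> x y - \<tau> x y)\<^sup>2" by simp
      then show "(\<sigma>' x y)\<^sup>2 \<le> (1/2) * (\<sigma> x y)\<^sup>2 + (1/2) * (\<tau> x y)\<^sup>2"
        by (simp add: \<sigma>'_def power2_eq_square algebra_simps)
    qed
    also have "\<dots> = (\<Sum>\<^sub>\<infinity>y. (1/2) * (b x y * (\<sigma> x y)\<^sup>2) + (1/2) * (b x y * (\<tau> x y)\<^sup>2))"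
      by (simp add: algebra_simps)
    also have "\<dots> = (1/2) * (\<Sum>\<^sub>\<infinity>y. b x y * (\<sigma> x y)\<^sup>2) + (1/2) * (\<Sum>\<^sub>\<infinity>y. b x y * (\<tau> x y)\<^sup>2)"
      by (simp only: infsum_add[OF summable_on_cmult_right summable_on_cmult_right]
          summable_neighbours infsum_cmult_right')
    also have "\<dots> \<le> m x"
    proof -
      have "(\<Sum>\<^sub>\<infinity>y. b x y * (\<sigma> x y)\<^sup>2) \<le> m x" "(\<Sum>\<^sub>\<infinity>y. b x y * (\<tau> x y)\<^sup>2) \<le> m x"
        using assms(2) \<tau>(2) by (auto simp: intrinsic_iff)
      then show ?thesis by simp
    qed
    finally show "(\<Sum>\<^sub>\<infinity>y. b x y * (\<sigma>' x y)\<^sup>2) \<le> m x" .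
  qed
  moreover have "finite_balls \<sigma>'"
    unfolding finite_balls_def
  proof (intro allI impI)
    fix x and R :: real assume "R \<ge> 0"
    then have "finite {y. \<sigma> x y \<le> 2 * R}"
      using assms(3) by (simp add: finite_balls_def)
    moreover have "{y. \<sigma>' x y \<le> R} \<subseteq> {y. \<sigma> x y \<le> 2 * R}"
    proof safe
      fix y assume "\<sigma>' x y \<le> R"
      then show "\<sigma> x y \<le> 2 * R" using nonneg(2)[of x y] by (simp add: \<sigma>'_def)
    qed
    ultimately show "finite {y. \<sigma>' x y \<le> R}" by (rule rev_finite_subset)
  qed
  ultimately show ?thesis unfolding is_metric_def by blast
qed

section \<open>Cut-off functions from an intrinsic pseudo metric\<close>

text \<open>These functions are \<open>1\<close>-Lipschitz for \<open>\<sigma>\<close>, so their gradients are at most \<open>1\<close>.\<close>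

lemma cutoff_sequence_of_pseudo_metric:
  assumes "pseudo_metric \<sigma>" "intrinsic b m \<sigma>" "finite_balls \<sigma>"
  shows "cutoff_sequence b m (\<lambda>n x. max 0 (1 - \<sigma> x\<^sub>0 x / real (Suc n)))"
proof -
  let ?\<phi> = "\<lambda>n x. max 0 (1 - \<sigma> x\<^sub>0 x / real (Suc n))"
  have "finite {x. ?\<phi> n x \<noteq> 0}" for n
  proof (rule finite_subset)
    show "{x. ?\<phi> n x \<noteq> 0} \<subseteq> {x. \<sigma> x\<^sub>0 x \<le> real (Suc n)}"
      by (auto simp: max_def field_simps split: if_splits)
    show "finite {x. \<sigma> x\<^sub>0 x \<le> real (Suc n)}"
      using assms(3) by (simp add: finite_balls_def)
  qed
  moreover have "(\<lambda>n. ?\<phi> n x) \<longlonglongrightarrow> 1" for x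
  proof -
    have "(\<lambda>n. 1 - \<sigma> x\<^sub>0 x / real (Suc n)) \<longlonglongrightarrow> 1 - 0"
      by (intro tendsto_diff tendsto_const LIMSEQ_Suc[OF lim_const_over_n])
    from tendsto_max[OF tendsto_const[of 0] this] show ?thesis by simp
  qed
  moreover have "grad_norm b m (?\<phi> n) x \<le> 1" for n x
  proof -
    have "(\<Sum>\<^sub>\<infinity>y. b x y * (?\<phi> n x - ?\<phi> n y)\<^sup>2) \<le> (\<Sum>\<^sub>\<infinity>y. b x y * (\<sigma> x y)\<^sup>2)"
    proof (rule infsum_b_mono)
      fix y
      have tri: "\<bar>\<sigma> x\<^sub>0 x - \<sigma> x\<^sub>0 y\<bar> \<le> \<sigma> x y"
        using assms(1) unfolding pseudo_metric_def by (smt (verit))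
      have "\<bar>?\<phi> n x - ?\<phi> n y\<bar> \<le> \<bar>\<sigma> x\<^sub>0 x / real (Suc n) - \<sigma> x\<^sub>0 y / real (Suc n)\<bar>"
        by linarith
      also have "\<dots> = \<bar>\<sigma> x\<^sub>0 x - \<sigma> x\<^sub>0 y\<bar> / real (Suc n)"
        by (simp add: diff_divide_distrib[symmetric])
      also have "\<dots> \<le> \<bar>\<sigma> x\<^sub>0 x - \<sigma> x\<^sub>0 y\<bar>"
        by (simp add: field_simps)
      finally show "(?\<phi> n x - ?\<phi> n y)\<^sup>2 \<le> (\<sigma> x y)\<^sup>2"
        using tri by (intro abs_le_square_iff[THEN iffD1]) linarith
    qed
    also have "\<dots> \<le> m x" using assms(2) by (simp add: intrinsic_iff)
    finally show ?thesis
      using m_pos[of x] unfolding grad_norm_def by (simp add: field_simps)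
  qed
  ultimately show ?thesis
    unfolding cutoff_sequence_def by (auto intro!: exI[of _ 1])
qed

section \<open>Steps of an intrinsic metric away from the root\<close>

text \<open>The edges from \<open>x\<close> to the next sphere have total weight \<open>m x \<kappa>\<^sub>+(x)\<close>, and their energy is at
  most \<open>m x\<close>. They cannot all have squared length above \<open>1 / \<kappa>\<^sub>+(x)\<close>.\<close>

lemma short_outward_step:
  assumes "intrinsic b m \<sigma>" "kappa_plus b m x\<^sub>0 x > 0"
  shows "\<exists>y\<in>S (Suc (depth x)). \<sigma> x y \<le> 1 / sqrt (kappa_plus b m x\<^sub>0 x)"
proof (rule ccontr)
  let ?t = "1 / sqrt (kappa_plus b m x\<^sub>0 x)" and ?up = "S (Suc (depth x))"
  assume "\<not> ?thesis"
  then have far: "?t < \<sigma> x y" if "y \<in> ?up" for y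
    using that by force
  have t_pos: "?t > 0" using assms(2) by simp
  have gap: "(\<sigma> x y)\<^sup>2 - ?t\<^sup>2 > 0" if "y \<in> ?up" for y
    using far[OF that] t_pos by (simp add: power_strict_mono del: zero_less_divide_iff)
  have "(\<Sum>y\<in>?up. b x y * (\<sigma> x y)\<^sup>2) \<le> (\<Sum>\<^sub>\<infinity>y. b x y * (\<sigma> x y)\<^sup>2)"
    by (intro finite_sum_le_infsum summable_neighbours finite_S) (auto simp: b_nonneg)
  also have "\<dots> \<le> m x" using assms(1) by (simp add: intrinsic_iff)
  also have "m x = (\<Sum>y\<in>?up. b x y) * ?t\<^sup>2"
    using assms(2) by (simp add: kappa_plus_sum[symmetric] power_divide)
  finally have "(\<Sum>y\<in>?up. b x y * ((\<sigma> x y)\<^sup>2 - ?t\<^sup>2)) \<le> 0"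
    by (simp add: right_diff_distrib sum_subtractf sum_distrib_right)
  moreover have nonneg: "b x y * ((\<sigma> x y)\<^sup>2 - ?t\<^sup>2) \<ge> 0" if "y \<in> ?up" for y
    using gap[OF that] b_nonneg by simp
  ultimately have "(\<Sum>y\<in>?up. b x y * ((\<sigma> x y)\<^sup>2 - ?t\<^sup>2)) = 0"
    by (intro antisym sum_nonneg) auto
  then have "\<forall>y\<in>?up. b x y = 0"
    using nonneg gap finite_S by (subst (asm) sum_nonneg_eq_0_iff) force+
  then have "m x * kappa_plus b m x\<^sub>0 x = 0"
    by (simp add: kappa_plus_sum)
  then show False using assms(2) m_pos[of x] by simp
qed

end

section \<open>Weakly spherically symmetric graphs\<close>

locale weakly_spherical_graph = rooted_graph +
  assumes wss: "weakly_spherically_symmetric b m x\<^sub>0"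
begin

abbreviation \<kappa> :: "nat \<Rightarrow> real" where "\<kappa> \<equiv> radial_value b x\<^sub>0 (kappa_plus b m x\<^sub>0)"
abbreviation dB :: "nat \<Rightarrow> real" where "dB \<equiv> boundary_measure b m x\<^sub>0"

abbreviation \<kappa>_series :: ennreal where
  "\<kappa>_series \<equiv> (\<Sum>r. ext_quotient 1 (sqrt (\<kappa> (Suc r))))"

abbreviation width_series :: ennreal where
  "width_series \<equiv> (\<Sum>r. ext_quotient (sqrt (min (vol m (S (Suc r))) (vol m (S (Suc r + 1)))))
      (sqrt (dB (Suc r))))"

text \<open>If \<open>S (Suc r)\<close> is nonempty, \<open>width r\<close> is the smaller of \<open>1 / sqrt (\<kappa>\<^sub>+(r))\<close> and
  \<open>1 / sqrt (\<kappa>\<^sub>-(r + 1))\<close>: up to a constant, the greatest length an intrinsic metric that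
  is radial can give to all edges between the spheres \<open>S r\<close> and \<open>S (Suc r)\<close> at once.\<close>

definition width :: "nat \<Rightarrow> real" where
  "width r = sqrt (min (vol m (S r)) (vol m (S (Suc r)))) / sqrt (dB r)"

lemma \<kappa>_depth: "\<kappa> (depth x) = kappa_plus b m x\<^sub>0 x"
  using wss by (intro radial_value_eq) (simp add: weakly_spherically_symmetric_def)

lemma \<kappa>_nonneg: "\<kappa> r \<ge> 0"
  by (simp add: radial_value_def kappa_plus_nonneg)

lemma boundary_outward: "depth x = r \<Longrightarrow> kappa_plus b m x\<^sub>0 x * vol m (S r) = dB r"
  using \<kappa>_depth[of x] by (simp add: boundary_measure_def)

lemma boundary_sum: "dB r = (\<Sum>x\<in>S r. \<Sum>y\<in>S (Suc r). b x y)"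
proof -
  have "dB r = (\<Sum>x\<in>S r. m x * \<kappa> r)"
    by (simp add: boundary_measure_def vol_S sum_distrib_right[symmetric] mult.commute)
  also have "\<dots> = (\<Sum>x\<in>S r. \<Sum>y\<in>S (Suc r). b x y)"
  proof (rule sum.cong)
    fix x assume "x \<in> S r"
    then have "depth x = r" by (simp add: in_S_iff)
    then show "m x * \<kappa> r = (\<Sum>y\<in>S (Suc r). b x y)"
      using kappa_plus_sum[of x] \<kappa>_depth[of x] by simp
  qed simp
  finally show ?thesis .
qed

text \<open>Counting the edges between \<open>S r\<close> and \<open>S (Suc r)\<close> from the outer sphere.\<close>

lemma boundary_inward:
  assumes "depth x = Suc r"
  shows "kappa_minus b m x\<^sub>0 x * vol m (S (Suc r)) = dB r"
proof -
  have "dB r = (\<Sum>y\<in>S (Suc r). \<Sum>x\<in>S r. b x y)"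
    unfolding boundary_sum by (rule sum.swap)
  also have "\<dots> = (\<Sum>y\<in>S (Suc r). m y * kappa_minus b m x\<^sub>0 x)"
  proof (rule sum.cong)
    fix y assume "y \<in> S (Suc r)"
    then have y: "depth y = Suc r" by (simp add: in_S_iff)
    have "kappa_minus b m x\<^sub>0 y = kappa_minus b m x\<^sub>0 x"
      using wss y assms unfolding weakly_spherically_symmetric_def radially_symmetric_def
      by metis
    then show "(\<Sum>x\<in>S r. b x y) = m y * kappa_minus b m x\<^sub>0 x"
      using kappa_minus_sum[OF y] by (simp add: b_sym)
  qed simp
  finally show ?thesis by (simp add: vol_S sum_distrib_right[symmetric] mult.commute)
qed

lemma dB_nonneg: "dB r \<ge> 0"
  by (simp add: boundary_sum sum_nonneg b_nonneg)

lemma dB_pos: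
  assumes "S (Suc r) \<noteq> {}" shows "dB r > 0"
proof -
  obtain y where y: "y \<in> S (Suc r)" using assms by blast
  then obtain x where x: "adjacent b y x" "depth x = r"
    by (auto simp: in_S_iff elim: predecessor)
  have "0 < b x y" using x by (simp add: adjacent_def b_sym)
  also have "\<dots> \<le> (\<Sum>y\<in>S (Suc r). b x y)"
    using y by (intro member_le_sum) (auto simp: finite_S b_nonneg)
  also have "\<dots> \<le> dB r"
    unfolding boundary_sum using x(2)
    by (intro member_le_sum[of x]) (auto simp: finite_S in_S_iff intro!: sum_nonneg b_nonneg)
  finally show ?thesis .
qed

lemma width_nonneg: "width r \<ge> 0"
  by (simp add: width_def vol_S_nonneg dB_nonneg)

lemma width_sq: "(width r)\<^sup>2 = min (vol m (S r)) (vol m (S (Suc r))) / dB r"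
  by (simp add: width_def power_divide dB_nonneg vol_S_nonneg)

text \<open>\<open>kappa_width\<close> makes increments of size \<open>width r\<close> admissible for vertices on both sides of the
  boundary; \<open>width_maximal\<close> says that no larger increments are, up to the factor \<open>C\<close>.\<close>

lemma kappa_width:
  "depth x = r \<Longrightarrow> kappa_plus b m x\<^sub>0 x * (width r)\<^sup>2 \<le> 1"
  "depth x = Suc r \<Longrightarrow> kappa_minus b m x\<^sub>0 x * (width r)\<^sup>2 \<le> 1"
proof -
  have *: "k * (width r)\<^sup>2 \<le> 1" if "k \<ge> 0" "k * v = dB r"
    "min (vol m (S r)) (vol m (S (Suc r))) \<le> v" for k v
  proof -
    have "k * (width r)\<^sup>2 \<le> k * (v / dB r)"
      unfolding width_sq using that dB_nonneg by (intro mult_left_mono divide_right_mono) auto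
    also have "\<dots> = dB r / dB r" using that(2) by simp
    also have "\<dots> \<le> 1" by simp
    finally show ?thesis .
  qed
  show "depth x = r \<Longrightarrow> kappa_plus b m x\<^sub>0 x * (width r)\<^sup>2 \<le> 1"
    by (rule *[OF kappa_plus_nonneg boundary_outward]) auto
  show "depth x = Suc r \<Longrightarrow> kappa_minus b m x\<^sub>0 x * (width r)\<^sup>2 \<le> 1"
    by (rule *[OF kappa_minus_nonneg boundary_inward]) auto
qed

lemma width_maximal:
  assumes x: "depth x = r" "kappa_plus b m x\<^sub>0 x * t\<^sup>2 \<le> C\<^sup>2"
    and y: "depth y = Suc r" "kappa_minus b m x\<^sub>0 y * t\<^sup>2 \<le> C\<^sup>2"
    and "C \<ge> 0"
  shows "\<bar>t\<bar> \<le> C * width r"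
proof -
  have *: "dB r * t\<^sup>2 \<le> C\<^sup>2 * v" if "k * t\<^sup>2 \<le> C\<^sup>2" "k * v = dB r" "v \<ge> 0" for k v
    using mult_right_mono[OF that(1,3)] by (simp add: that(2)[symmetric] mult_ac)
  have "dB r * t\<^sup>2 \<le> C\<^sup>2 * min (vol m (S r)) (vol m (S (Suc r)))"
    using *[OF x(2) boundary_outward[OF x(1)] vol_S_nonneg]
      *[OF y(2) boundary_inward[OF y(1)] vol_S_nonneg] by (simp add: min_def)
  moreover have "dB r > 0"
    using y(1) by (intro dB_pos) (auto simp: in_S_iff)
  ultimately have "t\<^sup>2 \<le> (C * width r)\<^sup>2"
    by (simp add: power_mult_distrib width_sq field_simps)
  then have "\<bar>t\<bar> \<le> \<bar>C * width r\<bar>" by (simp only: abs_le_square_iff)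
  then show ?thesis using assms(5) width_nonneg by simp
qed

lemma width_series_finite_iff:
  "width_series \<noteq> \<infinity> \<longleftrightarrow>
    (\<forall>r. dB (Suc r) \<noteq> 0) \<and> summable (\<lambda>r. width (Suc r))"
  by (subst suminf_ext_quotient_finite_iff) (auto simp: width_def vol_S_nonneg dB_nonneg)

lemma \<kappa>_series_finite_iff:
  "\<kappa>_series \<noteq> \<infinity> \<longleftrightarrow>
    (\<forall>r. \<kappa> (Suc r) \<noteq> 0) \<and> summable (\<lambda>r. 1 / sqrt (\<kappa> (Suc r)))"
  by (subst suminf_ext_quotient_finite_iff) (auto simp: \<kappa>_nonneg)

lemma \<kappa>_neq_0_imp_S_nonempty: "\<kappa> r \<noteq> 0 \<Longrightarrow> S r \<noteq> {}"
  by (auto simp: radial_value_def)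

lemma dB_neq_0_imp_S_nonempty: "dB r \<noteq> 0 \<Longrightarrow> S r \<noteq> {}"
  by (auto simp: boundary_sum)

text \<open>If \<open>\<kappa> r = 0\<close>, then also \<open>dB r = 0\<close> and both quotients are infinite. Otherwise the sphere is
  nonempty and its volume cancels.\<close>

lemma ext_quotient_vol_dB:
  "ext_quotient (sqrt (vol m (S r))) (sqrt (dB r)) = ext_quotient 1 (sqrt (\<kappa> r))"
proof (cases "\<kappa> r = 0")
  case True
  then show ?thesis by (simp add: ext_quotient_def boundary_measure_def)
next
  case False
  then have "vol m (S r) > 0"
    using \<kappa>_neq_0_imp_S_nonempty by (simp add: vol_S_pos_iff)
  then show ?thesis
    using False by (simp add: ext_quotient_def boundary_measure_def real_sqrt_mult)
qed

section \<open>Divergence of the series and completeness\<close>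

text \<open>The distance of two vertices is the sum of \<open>width k / sqrt 2\<close> over the spheres between them.
  The factor \<open>1 / sqrt 2\<close> is there because a vertex has edges on both sides, each of which uses up
  at most half of the admissible energy.\<close>

lemma pseudo_metric_of_width_series:
  assumes div: "width_series = \<infinity>"
  shows "\<exists>\<sigma>. pseudo_metric \<sigma> \<and> intrinsic b m \<sigma> \<and> finite_balls \<sigma> \<and>
    radially_symmetric b x\<^sub>0 (\<sigma> x\<^sub>0)"
proof -
  define \<rho> where "\<rho> r = (\<Sum>k<r. width k) / sqrt 2" for r
  define \<sigma> where "\<sigma> x y = \<bar>\<rho> (depth x) - \<rho> (depth y)\<bar>" for x y
  have step: "\<rho> (Suc r) - \<rho> r = width r / sqrt 2" for r
    by (simp add: \<rho>_def add_divide_distrib)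
  have "pseudo_metric \<sigma>"
    by (auto simp: pseudo_metric_def \<sigma>_def)
  moreover have "radially_symmetric b x\<^sub>0 (\<sigma> x\<^sub>0)"
    by (simp add: radially_symmetric_def \<sigma>_def)
  moreover have "intrinsic b m \<sigma>"
    unfolding intrinsic_iff
  proof
    fix x
    have up: "kappa_plus b m x\<^sub>0 x * (\<rho> (depth x) - \<rho> (Suc (depth x)))\<^sup>2 \<le> 1 / 2"
    proof -
      have "(\<rho> (depth x) - \<rho> (Suc (depth x)))\<^sup>2 = (width (depth x))\<^sup>2 / 2"
        by (subst power2_commute) (simp add: step power_divide)
      then show ?thesis using kappa_width(1)[of x "depth x"] by (simp only:) simp
    qed
    have down: "kappa_minus b m x\<^sub>0 x * (\<rho> (depth x) - \<rho> (depth x - 1))\<^sup>2 \<le> 1 / 2"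
    proof (cases "depth x")
      case (Suc r)
      then have "(\<rho> (depth x) - \<rho> (depth x - 1))\<^sup>2 = (width r)\<^sup>2 / 2"
        by (simp add: step power_divide)
      then show ?thesis using kappa_width(2)[OF Suc] by (simp only:)
    qed simp
    have "(\<Sum>\<^sub>\<infinity>y. b x y * (\<sigma> x y)\<^sup>2) \<le> m x * (1 / 2 + 1 / 2)"
      unfolding \<sigma>_def power2_abs radial_energy
      using up down m_pos[of x] by (intro mult_left_mono add_mono) auto
    then show "(\<Sum>\<^sub>\<infinity>y. b x y * (\<sigma> x y)\<^sup>2) \<le> m x" by simp
  qed
  moreover have "finite_balls \<sigma>"
  proof (cases "finite (UNIV :: 'a set)")
    case True
    then show ?thesis
      unfolding finite_balls_def by (metis finite_subset subset_UNIV)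
  next
    case False
    then have "dB r \<noteq> 0" for r
      using dB_pos[OF S_nonempty] by (metis less_irrefl)
    then have not_summable: "\<not> summable width"
      using div width_series_finite_iff by (simp add: summable_Suc_iff)
    have unbounded: "\<exists>N. \<forall>r\<ge>N. M < \<rho> r" for M
    proof (rule ccontr)
      assume "\<not> ?thesis"
      then have "\<exists>r\<ge>N. \<rho> r \<le> M" for N by (meson not_le)
      moreover have "mono \<rho>"
        by (auto simp: \<rho>_def mono_def intro!: divide_right_mono sum_mono2 width_nonneg)
      ultimately have "\<rho> N \<le> M" for N
        by (meson monoD order_trans)
      then have "(\<Sum>k<n. width k) \<le> M * sqrt 2" for n
        by (simp add: \<rho>_def field_simps)
      then have "summable width"
        by (intro summableI_nonneg_bounded width_nonneg)
      with not_summable show False ..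
    qed
    show ?thesis
      unfolding finite_balls_def
    proof (intro allI impI)
      fix x and R :: real
      obtain N where N: "\<And>r. r \<ge> N \<Longrightarrow> \<rho> (depth x) + R < \<rho> r"
        using unbounded by metis
      have "depth y < N" if "\<sigma> x y \<le> R" for y
        using that N[of "depth y"] by (force simp: \<sigma>_def not_less[symmetric])
      then have "{y. \<sigma> x y \<le> R} \<subseteq> (\<Union>r<N. S r)"
        by (auto simp: in_S_iff)
      then show "finite {y. \<sigma> x y \<le> R}"
        by (rule finite_subset) (simp add: finite_S)
    qed
  qed
  ultimately show ?thesis by blast
qed

text \<open>If the series converged, choose \<open>R\<close> such that all sums of widths beyond \<open>R\<close> are less than
  \<open>1 / (2 C)\<close>. Summing the increments from \<open>R\<close> to a sphere outside of the support bounds every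
  cut-off function by \<open>1 / 2\<close> on \<open>S R\<close>, where it should tend to \<open>1\<close>.\<close>

lemma width_series_of_radial_cutoffs:
  assumes cutoff: "cutoff_sequence b m \<phi>" and radial: "\<And>n. radially_symmetric b x\<^sub>0 (\<phi> n)"
  shows "width_series = \<infinity>"
proof (rule ccontr)
  assume "\<not> ?thesis"
  then have dB_neq_0: "\<And>r. dB (Suc r) \<noteq> 0" and "summable (\<lambda>r. width (Suc r))"
    using width_series_finite_iff by auto
  then have summable: "summable width" by (simp add: summable_Suc_iff)
  have S_ne: "S r \<noteq> {}" for r
    using dB_neq_0 dB_neq_0_imp_S_nonempty S_nonempty_antimono by blast
  obtain C where C: "C > 0" "\<And>n x. grad_norm b m (\<phi> n) x \<le> C"
    using cutoff by (auto simp: cutoff_sequence_def)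
  define g where "g n = radial_value b x\<^sub>0 (\<phi> n)" for n
  have \<phi>_eq: "\<phi> n x = g n (depth x)" for n x
    using radial_value_eq[OF radial] by (simp add: g_def)
  have energy: "kappa_plus b m x\<^sub>0 x * (g n (depth x) - g n (Suc (depth x)))\<^sup>2 +
      kappa_minus b m x\<^sub>0 x * (g n (depth x) - g n (depth x - 1))\<^sup>2 \<le> C\<^sup>2" (is "?E \<le> _") for n x
  proof -
    have "sqrt ?E \<le> C"
      using C(2)[of n x] m_pos[of x] by (simp add: grad_norm_def \<phi>_eq radial_energy)
    then show ?thesis
      using C(1) by (simp add: real_sqrt_le_iff' sqrt_le_D)
  qed
  have step: "\<bar>g n r - g n (Suc r)\<bar> \<le> C * width r" for n r
  proof -
    obtain x y where x: "depth x = r" and y: "depth y = Suc r"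
      using S_ne[of r] S_ne[of "Suc r"] by (auto simp: in_S_iff set_eq_iff)
    show ?thesis
    proof (rule width_maximal[OF x _ y])
      show "kappa_plus b m x\<^sub>0 x * (g n r - g n (Suc r))\<^sup>2 \<le> C\<^sup>2"
        using energy[of x n] kappa_minus_nonneg[of x] x
        by (smt (verit) mult_nonneg_nonneg zero_le_power2)
      show "kappa_minus b m x\<^sub>0 y * (g n r - g n (Suc r))\<^sup>2 \<le> C\<^sup>2"
        using energy[of y n] kappa_plus_nonneg[of y] y
        by (smt (verit) mult_nonneg_nonneg zero_le_power2 power2_commute diff_Suc_1)
    qed (use C in simp)
  qed
  obtain R where R: "\<And>n. sum width {R..<n} < 1 / (2 * C)"
  proof -
    have "\<exists>N. \<forall>m\<ge>N. \<forall>n. norm (sum width {m..<n}) < 1 / (2 * C)"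
      using summable C(1) unfolding summable_Cauchy by simp
    then obtain N where "\<And>n. norm (sum width {N..<n}) < 1 / (2 * C)" by blast
    then show thesis
      by (intro that[of N]) (metis abs_le_D1 order_refl order_le_less_trans real_norm_def)
  qed
  have small: "g n R < 1 / 2" for n
  proof -
    have "finite (depth ` {x. \<phi> n x \<noteq> 0})"
      using cutoff by (simp add: cutoff_sequence_def)
    then obtain L where L: "\<And>x. \<phi> n x \<noteq> 0 \<Longrightarrow> depth x < L"
      unfolding finite_nat_set_iff_bounded by auto
    obtain z where z: "depth z = R + L"
      using S_ne[of "R + L"] by (auto simp: in_S_iff set_eq_iff)
    have zero: "g n (R + L) = 0"
      using L[of z] z \<phi>_eq[of n z] by auto
    have "g n R - g n (R + k) \<le> C * sum width {R..<R + k}" for k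
    proof (induction k)
      case (Suc k)
      then show ?case using step[of n "R + k"] by (simp add: distrib_left)
    qed simp
    from this[of L] have "g n R \<le> C * sum width {R..<R + L}" by (simp add: zero)
    also have "\<dots> < C * (1 / (2 * C))"
      using R C(1) by (intro mult_strict_left_mono)
    finally show ?thesis using C(1) by simp
  qed
  obtain z where z: "depth z = R"
    using S_ne[of R] by (auto simp: in_S_iff set_eq_iff)
  have "(\<lambda>n. \<phi> n z) \<longlonglongrightarrow> 1"
    using cutoff by (simp add: cutoff_sequence_def)
  then have "1 \<le> (1 / 2 :: real)"
    by (rule LIMSEQ_le_const2) (use small z \<phi>_eq in \<open>auto simp: less_imp_le\<close>)
  then show False by simp
qed

text \<open>If the series converged, successive short steps outwards would lead to infinitely many
  vertices within a bounded distance of the first one. The path starts on \<open>S 1\<close> to match the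
  first index of the series.\<close>

lemma \<kappa>_series_of_pseudo_metric:
  assumes "pseudo_metric \<sigma>" "intrinsic b m \<sigma>" "finite_balls \<sigma>"
  shows "\<kappa>_series = \<infinity>"
proof (rule ccontr)
  let ?t = "\<lambda>n. 1 / sqrt (\<kappa> (Suc n))"
  assume "\<not> ?thesis"
  then have neq_0: "\<And>r. \<kappa> (Suc r) \<noteq> 0" and summable: "summable ?t"
    using \<kappa>_series_finite_iff by auto
  have \<kappa>_pos: "\<kappa> (Suc r) > 0" for r
    using neq_0[of r] \<kappa>_nonneg[of "Suc r"] by simp
  have "\<exists>s. \<forall>n. depth (s n) = Suc n \<and> \<sigma> (s n) (s (Suc n)) \<le> ?t n"
  proof (rule dependent_nat_choice)
    show "\<exists>x. depth x = Suc 0"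
      using \<kappa>_neq_0_imp_S_nonempty[OF neq_0[of 0]] by (auto simp: in_S_iff set_eq_iff)
  next
    fix x n assume "depth x = Suc n"
    moreover from this have "kappa_plus b m x\<^sub>0 x = \<kappa> (Suc n)"
      using \<kappa>_depth[of x] by simp
    ultimately show "\<exists>y. depth y = Suc (Suc n) \<and> \<sigma> x y \<le> ?t n"
      using short_outward_step[OF assms(2), of x] \<kappa>_pos by (auto simp: in_S_iff)
  qed
  then obtain s where s: "\<And>n. depth (s n) = Suc n" "\<And>n. \<sigma> (s n) (s (Suc n)) \<le> ?t n"
    by blast
  have "\<sigma> (s 0) (s n) \<le> (\<Sum>k<n. ?t k)" for n
  proof (induction n)
    case 0
    then show ?case using assms(1) by (simp add: pseudo_metric_def)
  next
    case (Suc n)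
    have "\<sigma> (s 0) (s (Suc n)) \<le> \<sigma> (s 0) (s n) + \<sigma> (s n) (s (Suc n))"
      using assms(1) by (simp add: pseudo_metric_def)
    then show ?case using Suc s(2)[of n] by simp
  qed
  also have "(\<Sum>k<n. ?t k) \<le> suminf ?t" for n
    by (rule sum_le_suminf[OF summable]) (auto simp: \<kappa>_nonneg)
  finally have "range s \<subseteq> {y. \<sigma> (s 0) y \<le> suminf ?t}" by blast
  moreover have "finite {y. \<sigma> (s 0) y \<le> suminf ?t}"
    using assms(3) suminf_nonneg[OF summable] by (simp add: finite_balls_def \<kappa>_nonneg)
  ultimately have "finite (range s)" by (rule finite_subset)
  moreover have "inj s"
    by (rule injI) (metis s(1) Suc_inject)
  ultimately show False
    using range_inj_infinite by blast
qed

text \<open>Since \<open>min (m(S\<^sub>r)) (m(S\<^sub>r\<^sub>+\<^sub>1)) \<ge> min 1 (1 / K) m(S\<^sub>r)\<close>, the terms of the two series are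
  comparable.\<close>

lemma width_series_of_\<kappa>_series:
  assumes "K > 0" and K: "\<And>r. r \<ge> 1 \<Longrightarrow> vol m (S r) \<le> K * vol m (S (r + 1))"
    and div: "\<kappa>_series = \<infinity>"
  shows "width_series = \<infinity>"
proof (rule ccontr)
  assume "\<not> ?thesis"
  then have neq_0: "\<And>r. dB (Suc r) \<noteq> 0" and summable: "summable (\<lambda>r. width (Suc r))"
    using width_series_finite_iff by auto
  define c where "c = min 1 (1 / K)"
  have c: "c > 0" using \<open>K > 0\<close> by (simp add: c_def)
  have bound: "1 / sqrt (\<kappa> (Suc r)) \<le> width (Suc r) / sqrt c" for r
  proof -
    let ?v = "vol m (S (Suc r))"
    have v: "?v > 0"
      using dB_neq_0_imp_S_nonempty[OF neq_0] by (simp add: vol_S_pos_iff)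
    have "c * ?v \<le> 1 * ?v" "c * ?v \<le> 1 / K * ?v"
      using v by (intro mult_right_mono; simp add: c_def)+
    moreover have "1 / K * ?v \<le> vol m (S (Suc (Suc r)))"
      using K[of "Suc r"] \<open>K > 0\<close> by (simp add: field_simps)
    ultimately have "c * ?v \<le> min ?v (vol m (S (Suc (Suc r))))" by simp
    then have "sqrt c * (sqrt ?v / sqrt (dB (Suc r))) \<le> width (Suc r)"
      unfolding width_def times_divide_eq_right real_sqrt_mult[symmetric]
      by (intro divide_right_mono) (auto simp: dB_nonneg)
    moreover have "sqrt ?v / sqrt (dB (Suc r)) = 1 / sqrt (\<kappa> (Suc r))"
      using v by (simp add: boundary_measure_def real_sqrt_mult)
    ultimately have "sqrt c * (1 / sqrt (\<kappa> (Suc r))) \<le> width (Suc r)" by simp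
    then show ?thesis
      using c by (simp add: pos_le_divide_eq mult.commute)
  qed
  have "summable (\<lambda>r. 1 / sqrt (\<kappa> (Suc r)))"
    by (rule summable_comparison_test'[OF summable_divide[OF summable]])
       (use bound in \<open>simp add: \<kappa>_nonneg\<close>)
  moreover have "\<kappa> (Suc r) \<noteq> 0" for r
    using neq_0[of r] by (auto simp: boundary_measure_def)
  ultimately show False
    using div \<kappa>_series_finite_iff by blast
qed

end

theorem theorem4p1:
  fixes b :: "'a::countable \<Rightarrow> 'a \<Rightarrow> real" and m :: "'a \<Rightarrow> real" and x\<^sub>0 :: 'a
  assumes "weighted_graph b m"
    and "connected_graph b"
    and "locally_finite_graph b"
    and "weakly_spherically_symmetric b m x\<^sub>0"
  shows
    "let S = dsphere b x\<^sub>0;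
         kappa = radial_value b x\<^sub>0 (kappa_plus b m x\<^sub>0);
         dB = boundary_measure b m x\<^sub>0;
         i = (chi_complete b m \<and>
              (\<exists>\<phi>. cutoff_sequence b m \<phi> \<and> (\<forall>n. radially_symmetric b x\<^sub>0 (\<phi> n))));
         ii = (\<exists>\<sigma>. pseudo_metric \<sigma> \<and> intrinsic b m \<sigma> \<and> finite_balls \<sigma> \<and>
                    radially_symmetric b x\<^sub>0 (\<sigma> x\<^sub>0));
         iii = ((\<Sum>r. ext_quotient (sqrt (min (vol m (S (Suc r))) (vol m (S (Suc r + 1)))))
                                   (sqrt (dB (Suc r)))) = \<infinity>);
         iv = (\<exists>\<sigma>. is_metric \<sigma> \<and> intrinsic b m \<sigma> \<and> finite_balls \<sigma>);
         v = ((\<Sum>r. ext_quotient (sqrt (vol m (S (Suc r)))) (sqrt (dB (Suc r)))) =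
                (\<Sum>r. ext_quotient 1 (sqrt (kappa (Suc r)))) \<and>
              (\<Sum>r. ext_quotient 1 (sqrt (kappa (Suc r)))) = \<infinity>)
     in (i \<longleftrightarrow> ii) \<and> (ii \<longleftrightarrow> iii) \<and>
        (i \<longrightarrow> iv) \<and> (ii \<longrightarrow> iv) \<and> (iii \<longrightarrow> iv) \<and>
        (iv \<longrightarrow> v) \<and>
        ((\<exists>K>0. \<forall>r\<ge>1. vol m (S r) \<le> K * vol m (S (r + 1))) \<longrightarrow>
           (i \<longleftrightarrow> ii) \<and> (ii \<longleftrightarrow> iii) \<and> (iii \<longleftrightarrow> iv) \<and> (iv \<longleftrightarrow> v))"
proof -
  interpret weakly_spherical_graph b m x\<^sub>0
    using assms by unfold_locales
  let ?i = "chi_complete b m \<and>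
      (\<exists>\<phi>. cutoff_sequence b m \<phi> \<and> (\<forall>n. radially_symmetric b x\<^sub>0 (\<phi> n)))"
  let ?ii = "\<exists>\<sigma>. pseudo_metric \<sigma> \<and> intrinsic b m \<sigma> \<and> finite_balls \<sigma> \<and>
      radially_symmetric b x\<^sub>0 (\<sigma> x\<^sub>0)"
  let ?iii = "width_series = \<infinity>"
  let ?iv = "\<exists>\<sigma>. is_metric \<sigma> \<and> intrinsic b m \<sigma> \<and> finite_balls \<sigma>"
  let ?v = "(\<Sum>r. ext_quotient (sqrt (vol m (S (Suc r)))) (sqrt (dB (Suc r)))) =
      \<kappa>_series \<and>
      \<kappa>_series = \<infinity>"
  let ?K = "\<exists>K>0. \<forall>r\<ge>1. vol m (S r) \<le> K * vol m (S (r + 1))"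
  have 1: ?i if ?ii
  proof -
    from that obtain \<sigma> where \<sigma>: "pseudo_metric \<sigma>" "intrinsic b m \<sigma>" "finite_balls \<sigma>"
      "radially_symmetric b x\<^sub>0 (\<sigma> x\<^sub>0)" by blast
    have "radially_symmetric b x\<^sub>0 (\<lambda>x. max 0 (1 - \<sigma> x\<^sub>0 x / real (Suc n)))" for n
      using \<sigma>(4) unfolding radially_symmetric_def by metis
    with cutoff_sequence_of_pseudo_metric[OF \<sigma>(1-3)] show ?thesis
      unfolding chi_complete_def by blast
  qed
  have 2: ?iii if ?i
    using that width_series_of_radial_cutoffs by blast
  have 3: ?ii if ?iii
    using that by (rule pseudo_metric_of_width_series)
  have 4: ?iv if ?ii
    using that intrinsic_metric_of_pseudo_metric by blast
  have 5: ?v if ?iv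
    using that \<kappa>_series_of_pseudo_metric by (auto simp: is_metric_def ext_quotient_vol_dB)
  have 6: ?iii if ?K ?v
    using that width_series_of_\<kappa>_series by blast
  show ?thesis
    unfolding Let_def using 1 2 3 4 5 6 by argo
qed

end
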